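(* Let $K$ be an infinite field and $n\ge 1$ an integer. Let $K(\mathbf{x},\mathbf{y})=K(x_1,y_1,\dots,x_n,y_n)$ and $f_{i,j}=x_iy_j-y_ix_j$ for $1\le i,j\le n$. An element $q\in K(\mathbf{x},\mathbf{y})$ is invariant under the action of $\mathrm{GL}_2(K)$ if and only if $q$ can be written as a rational function over $K$ in the quotients $f_{i,j}/f_{k,l}$, $1\le i,j,k,l\le n$, $k\neq l$; that is, $$K(\mathbf{x},\mathbf{y})^{\mathrm{GL}_2}=K\left(\frac{f_{i,j}}{f_{k,l}}: 1\le i,j,k,l\le n,\ k\ne l\right).$$ Moreover, if $n\ge 2$, every invariant $q\in K(\mathbf{x},\mathbf{y})^{\mathrm{GL}_2}$ satisfies $$q(x_1,y_1,\dots,x_n,y_n)=q\left(\frac{f_{1,1}}{f_{1,2}},\frac{f_{2,1}}{f_{1,2}},\dots,\frac{f_{1,n}}{f_{1,2}},\frac{f_{2,n}}{f_{1,2}}\right),$$ where the right-hand side is obtained from $q$, written as a quotient of two polynomials in lowest terms, by substituting $x_i\mapsto f_{1,i}/f_{1,2}$ and $y_i\mapsto f_{2,i}/f_{1,2}$ for all $1\le i\le n$.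
   Context: The group $\mathrm{GL}_2(K)$ acts on the polynomial ring $K[x_1,y_1,\dots,x_n,y_n]$, and hence on its quotient field $K(\mathbf{x},\mathbf{y})$, by matrix-vector multiplication on each pair of variables $(x_i,y_i)$: for $G=\begin{pmatrix}a&b\\c&d\end{pmatrix}$, the element $G\cdot q$ is obtained from $q$ by substituting $x_i\mapsto ax_i+by_i$ and $y_i\mapsto cx_i+dy_i$ simultaneously for all $i$. The field of elements fixed by all $G\in\mathrm{GL}_2(K)$ is denoted $K(\mathbf{x},\mathbf{y})^{\mathrm{GL}_2}$. When there are no quotients $f_{i,j}/f_{k,l}$ with $k\ne l$ (the case $n=1$), the field on the right-hand side is $K$. *)

theory Defs
  imports
    "HOL-Library.Poly_Mapping"
    "HOL-Analysis.Determinants"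
    "HOL-Computational_Algebra.Fraction_Field"
begin

hide_const (open) Rat.Fract

section \<open>Polynomials and rational functions in the pairs of variables \<open>(x\<^sub>i, y\<^sub>i)\<close>\<close>

datatype pvar = X nat | Y nat

text \<open>
  The order on variables has no mathematical significance: the library's proof that
  polynomial rings are integral domains needs a linear order on the monomials.
\<close>

primrec pvar_code :: "pvar \<Rightarrow> nat" where
  "pvar_code (X i) = 2 * i"
| "pvar_code (Y i) = 2 * i + 1"

lemma pvar_code_inject: "pvar_code v = pvar_code w \<Longrightarrow> v = w"
  by (cases v; cases w) (simp_all, presburger+)

instantiation pvar :: linorder
begin

definition less_eq_pvar :: "pvar \<Rightarrow> pvar \<Rightarrow> bool" where
  "v \<le> w \<longleftrightarrow> pvar_code v \<le> pvar_code w"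

definition less_pvar :: "pvar \<Rightarrow> pvar \<Rightarrow> bool" where
  "v < w \<longleftrightarrow> pvar_code v < pvar_code w"

instance
  by standard (auto simp: less_eq_pvar_def less_pvar_def intro: pvar_code_inject)

end

text \<open>
  Polynomials in all the variables \<open>x\<^sub>i, y\<^sub>i\<close> (\<open>i :: nat\<close>); a monomial is a finitely
  supported exponent map. The rings \<open>K[x\<^sub>1, y\<^sub>1, \<dots>, x\<^sub>n, y\<^sub>n]\<close> and their quotient fields
  are the subsets \<open>poly_ring n\<close> and \<open>rat_field n\<close> below.
\<close>

type_synonym 'k mpoly = "(pvar \<Rightarrow>\<^sub>0 nat) \<Rightarrow>\<^sub>0 'k"
type_synonym 'k ratfun = "'k mpoly fract"

definition const :: "'k::field \<Rightarrow> 'k mpoly" where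
  "const c = Poly_Mapping.single 0 c"

definition var :: "pvar \<Rightarrow> 'k::field mpoly" where
  "var v = Poly_Mapping.single (Poly_Mapping.single v 1) 1"

definition rat_of_poly :: "'k::field mpoly \<Rightarrow> 'k ratfun" where
  "rat_of_poly p = Fract p 1"

definition pvars :: "nat \<Rightarrow> pvar set" where
  "pvars n = X ` {1..n} \<union> Y ` {1..n}"

definition poly_ring :: "nat \<Rightarrow> 'k::field mpoly set" where
  "poly_ring n = {p. \<forall>m \<in> Poly_Mapping.keys p. Poly_Mapping.keys m \<subseteq> pvars n}"

definition rat_field :: "nat \<Rightarrow> 'k::field ratfun set" where
  "rat_field n = {Fract a b | a b. a \<in> poly_ring n \<and> b \<in> poly_ring n \<and> b \<noteq> 0}"

section \<open>Substitution\<close>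

text \<open>
  \<open>poly_subst h s p\<close> is the value of \<open>p\<close> in a commutative ring \<open>R\<close> when every variable
  \<open>v\<close> is replaced by \<open>s v\<close>, where \<open>h\<close> embeds the coefficient field into \<open>R\<close>.
\<close>

definition poly_subst :: "('k::field \<Rightarrow> 'r::comm_ring_1) \<Rightarrow> (pvar \<Rightarrow> 'r) \<Rightarrow> 'k mpoly \<Rightarrow> 'r" where
  "poly_subst h s p = (\<Sum>m \<in> Poly_Mapping.keys p. h (Poly_Mapping.lookup p m) * (\<Prod>v \<in> Poly_Mapping.keys m. s v ^ Poly_Mapping.lookup m v))"

definition rat_subst :: "(pvar \<Rightarrow> 'k::field ratfun) \<Rightarrow> 'k mpoly \<Rightarrow> 'k ratfun" where
  "rat_subst = poly_subst (\<lambda>c. rat_of_poly (const c))"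

section \<open>The action of \<open>GL\<^sub>2\<close> and its invariants\<close>

fun gl2_images :: "'k::field ^ 2 ^ 2 \<Rightarrow> pvar \<Rightarrow> 'k mpoly" where
  "gl2_images G (X i) = const (G $ 1 $ 1) * var (X i) + const (G $ 1 $ 2) * var (Y i)"
| "gl2_images G (Y i) = const (G $ 2 $ 1) * var (X i) + const (G $ 2 $ 2) * var (Y i)"

definition gl2_act_poly :: "'k::field ^ 2 ^ 2 \<Rightarrow> 'k mpoly \<Rightarrow> 'k mpoly" where
  "gl2_act_poly G = poly_subst const (gl2_images G)"

text \<open>
  The action on a quotient of polynomials is computed on an arbitrary representation;
  lemma \<open>gl2_act_Fract\<close> below shows that the choice does not matter.
\<close>

definition gl2_act :: "'k::field ^ 2 ^ 2 \<Rightarrow> 'k ratfun \<Rightarrow> 'k ratfun" where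
  "gl2_act G q =
     (case (SOME (a, b). b \<noteq> 0 \<and> q = Fract a b) of
        (a, b) \<Rightarrow> Fract (gl2_act_poly G a) (gl2_act_poly G b))"

definition gl2_invariants :: "nat \<Rightarrow> 'k::field ratfun set" where
  "gl2_invariants n = {q \<in> rat_field n. \<forall>G. invertible G \<longrightarrow> gl2_act G q = q}"

section \<open>Generated fields, the elements \<open>f\<^sub>i\<^sub>j\<close>, lowest terms\<close>

definition is_subfield :: "'a::field set \<Rightarrow> bool" where
  "is_subfield F \<longleftrightarrow>
     0 \<in> F \<and> 1 \<in> F \<and>
     (\<forall>x \<in> F. \<forall>y \<in> F. x + y \<in> F \<and> x * y \<in> F) \<and>
     (\<forall>x \<in> F. - x \<in> F \<and> inverse x \<in> F)"

definition adjoin :: "'k::field ratfun set \<Rightarrow> 'k ratfun set" where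
  "adjoin S = is_subfield hull ((\<lambda>c. rat_of_poly (const c)) ` UNIV \<union> S)"

definition fij :: "nat \<Rightarrow> nat \<Rightarrow> 'k::field ratfun" where
  "fij i j = rat_of_poly (var (X i) * var (Y j) - var (Y i) * var (X j))"

fun f_images :: "pvar \<Rightarrow> 'k::field ratfun" where
  "f_images (X i) = fij 1 i / fij 1 2"
| "f_images (Y i) = fij 2 i / fij 1 2"

text \<open>
  Divisibility is taken in the ambient ring in all variables. A divisor of a nonzero element
  of \<open>poly_ring n\<close> lies in \<open>poly_ring n\<close>, so this agrees with coprimality in \<open>poly_ring n\<close>.
\<close>

definition lowest_terms :: "nat \<Rightarrow> 'k::field ratfun \<Rightarrow> 'k mpoly \<Rightarrow> 'k mpoly \<Rightarrow> bool" where
  "lowest_terms n q a b \<longleftrightarrow>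
     a \<in> poly_ring n \<and> b \<in> poly_ring n \<and> b \<noteq> 0 \<and> q = Fract a b \<and>
     (\<forall>c. c dvd a \<and> c dvd b \<longrightarrow> c dvd 1)"

section \<open>The action on rational functions is well defined\<close>

definition monom_subst :: "(pvar \<Rightarrow> 'r::comm_ring_1) \<Rightarrow> (pvar \<Rightarrow>\<^sub>0 nat) \<Rightarrow> 'r" where
  "monom_subst s m = (\<Prod>v \<in> Poly_Mapping.keys m. s v ^ Poly_Mapping.lookup m v)"

lemma monom_subst_superset:
  assumes "finite V" "Poly_Mapping.keys m \<subseteq> V"
  shows "monom_subst s m = (\<Prod>v \<in> V. s v ^ Poly_Mapping.lookup m v)"
  unfolding monom_subst_def
  by (rule prod.mono_neutral_left) (use assms in \<open>auto simp: in_keys_iff\<close>)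

lemma monom_subst_add: "monom_subst s (m + m') = monom_subst s m * monom_subst s m'"
proof -
  let ?V = "Poly_Mapping.keys m \<union> Poly_Mapping.keys m'"
  have "Poly_Mapping.keys (m + m') \<subseteq> ?V"
    by (rule keys_add)
  then have "monom_subst s (m + m') = (\<Prod>v \<in> ?V. s v ^ Poly_Mapping.lookup (m + m') v)"
    by (intro monom_subst_superset) auto
  also have "\<dots> = (\<Prod>v \<in> ?V. s v ^ Poly_Mapping.lookup m v) * (\<Prod>v \<in> ?V. s v ^ Poly_Mapping.lookup m' v)"
    by (simp add: lookup_add power_add prod.distrib)
  also have "\<dots> = monom_subst s m * monom_subst s m'"
    by (subst (1 2) monom_subst_superset[of ?V]) auto
  finally show ?thesis .
qed

locale coeff_hom =
  fixes h :: "'k::field \<Rightarrow> 'r::comm_ring_1"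
  assumes h0: "h 0 = 0" and h1: "h 1 = 1"
    and hadd: "h (c + d) = h c + h d" and hmult: "h (c * d) = h c * h d"
begin

lemma subst_superset:
  assumes "finite M" "Poly_Mapping.keys p \<subseteq> M"
  shows "poly_subst h s p = (\<Sum>m \<in> M. h (Poly_Mapping.lookup p m) * monom_subst s m)"
  unfolding poly_subst_def monom_subst_def
  by (rule sum.mono_neutral_left) (use assms in \<open>auto simp: in_keys_iff h0\<close>)

lemma subst_0: "poly_subst h s 0 = 0"
  by (simp add: poly_subst_def)

lemma subst_add: "poly_subst h s (p + q) = poly_subst h s p + poly_subst h s q"
proof -
  let ?M = "Poly_Mapping.keys p \<union> Poly_Mapping.keys q"
  have "Poly_Mapping.keys (p + q) \<subseteq> ?M"
    by (rule keys_add)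
  then show ?thesis
    by (subst (1 2 3) subst_superset[of ?M])
      (auto simp: lookup_add hadd sum.distrib algebra_simps)
qed

lemma subst_sum: "finite A \<Longrightarrow> poly_subst h s (\<Sum>x \<in> A. g x) = (\<Sum>x \<in> A. poly_subst h s (g x))"
  by (induction A rule: finite_induct) (simp_all add: subst_0 subst_add)

lemma subst_single: "poly_subst h s (Poly_Mapping.single m c) = h c * monom_subst s m"
  by (subst subst_superset[of "{m}"]) (auto simp: lookup_single)

lemma poly_sum_single: "p = (\<Sum>m \<in> Poly_Mapping.keys p. Poly_Mapping.single m (Poly_Mapping.lookup p m))"
proof (rule poly_mapping_eqI)
  fix k
  show "Poly_Mapping.lookup p k = Poly_Mapping.lookup (\<Sum>m \<in> Poly_Mapping.keys p. Poly_Mapping.single m (Poly_Mapping.lookup p m)) k"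
    by (auto simp: lookup_sum lookup_single when_def in_keys_iff)
qed

lemma subst_mult: "poly_subst h s (p * q) = poly_subst h s p * poly_subst h s q"
proof -
  have "p * q = (\<Sum>m \<in> Poly_Mapping.keys p. \<Sum>m' \<in> Poly_Mapping.keys q.
      Poly_Mapping.single (m + m') (Poly_Mapping.lookup p m * Poly_Mapping.lookup q m'))"
    by (subst poly_sum_single[of p], subst poly_sum_single[of q])
      (simp add: sum_product mult_single)
  then have "poly_subst h s (p * q) = (\<Sum>m \<in> Poly_Mapping.keys p. \<Sum>m' \<in> Poly_Mapping.keys q.
      (h (Poly_Mapping.lookup p m) * monom_subst s m) * (h (Poly_Mapping.lookup q m') * monom_subst s m'))"
    by (simp add: subst_sum subst_single hmult monom_subst_add algebra_simps)
  also have "\<dots> = poly_subst h s p * poly_subst h s q"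
    by (subst (1 2) subst_superset) (auto simp: sum_product)
  finally show ?thesis .
qed

lemma subst_const: "poly_subst h s (const c) = h c"
  by (simp add: const_def subst_single monom_subst_def)

lemma subst_1: "poly_subst h s 1 = 1"
  using subst_const[of s 1] by (simp add: const_def h1)

lemma subst_var: "poly_subst h s (var v) = s v"
  by (simp add: var_def subst_single monom_subst_def h1)

lemma subst_power: "poly_subst h s (p ^ k) = poly_subst h s p ^ k"
  by (induction k) (simp_all add: subst_1 subst_mult)

lemma subst_prod: "finite A \<Longrightarrow> poly_subst h s (\<Prod>x \<in> A. g x) = (\<Prod>x \<in> A. poly_subst h s (g x))"
  by (induction A rule: finite_induct) (simp_all add: subst_1 subst_mult)

end

lemma const_add: "const (c + d) = const c + const d"
  by (simp add: const_def single_add)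

lemma const_mult: "const (c * d) = const c * const d"
  by (simp add: const_def mult_single)

interpretation const_hom: coeff_hom const
  by standard (simp_all add: const_add const_mult, simp_all add: const_def)

lemma poly_subst_const_comp:
  "poly_subst const s (poly_subst const t p) = poly_subst const (\<lambda>v. poly_subst const s (t v)) p"
  by (subst (2 3) poly_subst_def)
    (simp add: const_hom.subst_sum const_hom.subst_mult const_hom.subst_const
      const_hom.subst_prod const_hom.subst_power)

lemma var_power: "var v ^ k = Poly_Mapping.single (Poly_Mapping.single v k) 1"
  by (induction k) (simp_all add: var_def mult_single flip: single_add)

lemma monom_subst_var: "monom_subst var m = Poly_Mapping.single m 1"
proof -
  have *: "(\<Prod>v \<in> A. Poly_Mapping.single (Poly_Mapping.single v (Poly_Mapping.lookup m v)) (1 :: 'a))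
      = Poly_Mapping.single (\<Sum>v \<in> A. Poly_Mapping.single v (Poly_Mapping.lookup m v)) 1"
    if "finite A" for A
    using that by (induction A rule: finite_induct) (simp_all add: mult_single)
  have "(\<Sum>v \<in> Poly_Mapping.keys m. Poly_Mapping.single v (Poly_Mapping.lookup m v)) = m"
    by (rule poly_mapping_eqI) (auto simp: lookup_sum lookup_single when_def in_keys_iff)
  then show ?thesis
    by (simp add: monom_subst_def var_power *)
qed

lemma poly_subst_var: "poly_subst const var p = p"
proof -
  have "poly_subst const var p = (\<Sum>m \<in> Poly_Mapping.keys p. Poly_Mapping.single m (Poly_Mapping.lookup p m))"
    by (subst const_hom.subst_superset[of "Poly_Mapping.keys p"])
      (simp_all add: monom_subst_var const_def mult_single)
  then show ?thesis
    using const_hom.poly_sum_single[of p] by simp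
qed

lemma gl2_act_poly_mult: "gl2_act_poly G (p * q) = gl2_act_poly G p * gl2_act_poly G q"
  by (simp add: gl2_act_poly_def const_hom.subst_mult)

lemma gl2_act_poly_comp: "gl2_act_poly G (gl2_act_poly H p) = gl2_act_poly (H ** G) p"
proof -
  have "poly_subst const (gl2_images G) (gl2_images H v) = gl2_images (H ** G) v" for v
    by (cases v)
      (simp_all add: const_hom.subst_add const_hom.subst_mult const_hom.subst_const
        const_hom.subst_var matrix_matrix_mult_def sum_2 const_add const_mult algebra_simps)
  then show ?thesis
    by (simp add: gl2_act_poly_def poly_subst_const_comp)
qed

lemma gl2_act_poly_one:
  fixes p :: "'k::field mpoly"
  shows "gl2_act_poly (mat 1) p = p"
proof -
  have "gl2_images (mat 1) v = (var v :: 'k mpoly)" for v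
    by (cases v) (simp_all add: mat_def, simp_all add: const_def)
  then have "gl2_images (mat 1) = (var :: pvar \<Rightarrow> 'k mpoly)"
    by blast
  then show ?thesis
    by (simp add: gl2_act_poly_def poly_subst_var)
qed

lemma gl2_act_poly_eq_0_iff:
  assumes "invertible G"
  shows "gl2_act_poly G p = 0 \<longleftrightarrow> p = 0"
proof
  assume *: "gl2_act_poly G p = 0"
  obtain H where "G ** H = mat 1"
    using assms by (auto simp: invertible_def)
  then have "p = gl2_act_poly H (gl2_act_poly G p)"
    by (simp add: gl2_act_poly_comp gl2_act_poly_one)
  with * show "p = 0"
    by (simp add: gl2_act_poly_def const_hom.subst_0)
qed (simp add: gl2_act_poly_def const_hom.subst_0)

lemma gl2_act_Fract:
  assumes "invertible G" "b \<noteq> 0"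
  shows "gl2_act G (Fract a b) = Fract (gl2_act_poly G a) (gl2_act_poly G b)"
proof -
  let ?P = "\<lambda>(c, d). d \<noteq> 0 \<and> Fract a b = Fract c d"
  obtain c d where cd: "(SOME x. ?P x) = (c, d)"
    by (cases "SOME x. ?P x")
  have "?P (SOME x. ?P x)"
    by (rule someI[of ?P "(a, b)"]) (use assms in simp)
  then have d: "d \<noteq> 0" and "Fract a b = Fract c d"
    unfolding cd by auto
  then have "a * d = c * b"
    using assms by (simp add: eq_fract)
  then have "gl2_act_poly G a * gl2_act_poly G d = gl2_act_poly G c * gl2_act_poly G b"
    by (simp flip: gl2_act_poly_mult)
  then show ?thesis
    using assms d by (simp add: gl2_act_def cd eq_fract gl2_act_poly_eq_0_iff)
qed

end

theory Submission
  imports Defs "HOL-Computational_Algebra.Polynomial"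
begin

text \<open>
  Write an invariant \<open>q = a / b\<close> in lowest terms and let \<open>g\<close> be a generic \<open>2 \<times> 2\<close> matrix, acting
  on the pairs \<open>(x\<^sub>i, y\<^sub>i)\<close>. As \<open>K\<close> is infinite, invariance gives the polynomial identity
  \<open>a (g \<sqdot> b) = (g \<sqdot> a) b\<close>, and as the polynomial ring is factorial, \<open>b\<close> divides \<open>g \<sqdot> b\<close>.
  Now let \<open>t\<close> be a point over the function field that some matrix moves to the
  generic point. Specializing \<open>g\<close> to that matrix and the variables to \<open>t\<close>, the divisibility
  shows \<open>b(t) \<noteq> 0\<close>, and then the identity shows \<open>q = a(t) / b(t)\<close>.
  For \<open>n \<ge> 2\<close> take \<open>t\<close> to be the point with coordinates \<open>f\<^sub>1\<^sub>i / f\<^sub>1\<^sub>2\<close>, \<open>f\<^sub>2\<^sub>i / f\<^sub>1\<^sub>2\<close>;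
  for \<open>n = 1\<close> take \<open>t = (1, 0)\<close>.
\<close>

hide_const (open) Rat.Fract

section \<open>Substitution homomorphisms\<close>

locale unital_ring_hom =
  fixes H :: "'r::comm_ring_1 \<Rightarrow> 's::comm_ring_1"
  assumes map_one: "H 1 = 1"
    and map_add: "H (x + y) = H x + H y" and map_mult: "H (x * y) = H x * H y"
begin

lemma map_zero: "H 0 = 0"
  using map_add[of 0 0] by simp

lemma map_power: "H (x ^ k) = H x ^ k"
  by (induction k) (simp_all add: map_one map_mult)

lemma map_sum: "H (\<Sum>x\<in>A. g x) = (\<Sum>x\<in>A. H (g x))"
  by (induction A rule: infinite_finite_induct) (simp_all add: map_zero map_add)

lemma map_prod: "H (\<Prod>x\<in>A. g x) = (\<Prod>x\<in>A. H (g x))"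
  by (induction A rule: infinite_finite_induct) (simp_all add: map_one map_mult)

lemma map_poly_subst: "H (poly_subst h s p) = poly_subst (\<lambda>c. H (h c)) (\<lambda>v. H (s v)) p"
  by (simp add: poly_subst_def map_sum map_mult map_prod map_power)

end

lemma (in coeff_hom) unital_ring_hom_subst: "unital_ring_hom (poly_subst h s)"
  by standard (simp_all add: subst_1 subst_add subst_mult)

lemma (in coeff_hom) subst_comp:
  "poly_subst h s (poly_subst const t p) = poly_subst h (\<lambda>v. poly_subst h s (t v)) p"
  by (simp add: unital_ring_hom.map_poly_subst[OF unital_ring_hom_subst] subst_const)

lemma (in coeff_hom) subst_uminus: "poly_subst h s (- p) = - poly_subst h s p"
proof -
  have "poly_subst h s (- p) + poly_subst h s p = 0"
    by (simp flip: subst_add add: subst_0)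
  then show ?thesis
    by (simp add: eq_neg_iff_add_eq_0)
qed

lemma (in coeff_hom) subst_diff: "poly_subst h s (p - q) = poly_subst h s p - poly_subst h s q"
  using subst_add[of s p "- q"] by (simp add: subst_uminus)

lemma unital_ring_hom_poly: "unital_ring_hom (\<lambda>P. poly P r)"
  by standard simp_all

lemma unital_ring_hom_pCons: "unital_ring_hom (\<lambda>c. [:c:])"
  by standard simp_all

lemma const_0: "const 0 = 0" and const_1: "const 1 = 1"
  by (simp_all add: const_def)

lemma const_eq_0_iff: "const c = 0 \<longleftrightarrow> c = 0"
  by (metis const_def lookup_single_eq lookup_zero single_zero)

lemma const_inject: "const c = const d \<longleftrightarrow> c = d"
  by (metis const_def lookup_single_eq)

lemma const_diff: "const (c - d) = const c - const d"
  by (metis add_diff_cancel diff_add_cancel const_add)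

interpretation pconst_hom: coeff_hom "\<lambda>c. [:const c:]"
  by standard (simp_all add: const_add const_mult const_0 const_1)

lemma unital_ring_hom_rat_of_poly: "unital_ring_hom rat_of_poly"
  by standard (simp_all add: rat_of_poly_def One_fract_def)

interpretation rat_hom: unital_ring_hom rat_of_poly
  by (rule unital_ring_hom_rat_of_poly)

interpretation rconst_hom: coeff_hom "\<lambda>c. rat_of_poly (const c)"
  by standard (simp_all add: const_add const_mult const_0 const_1
      rat_hom.map_zero rat_hom.map_one rat_hom.map_add rat_hom.map_mult)

lemma rat_of_poly_eq_0_iff: "rat_of_poly p = 0 \<longleftrightarrow> p = 0"
  by (simp add: rat_of_poly_def eq_fract Zero_fract_def)

lemma Fract_eq_divide: "b \<noteq> 0 \<Longrightarrow> Fract a b = rat_of_poly a / rat_of_poly b"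
  by (simp add: rat_of_poly_def)

section \<open>Polynomials in a given set of variables\<close>

definition polys_in :: "pvar set \<Rightarrow> 'k::field mpoly set" where
  "polys_in S = {p. \<forall>m \<in> Poly_Mapping.keys p. Poly_Mapping.keys m \<subseteq> S}"

lemma poly_ring_eq_polys_in: "poly_ring n = polys_in (pvars n)"
  by (simp add: poly_ring_def polys_in_def)

lemma poly_subst_cong:
  assumes "p \<in> polys_in S" "\<And>v. v \<in> S \<Longrightarrow> s v = t v"
  shows "poly_subst h s p = poly_subst h t p"
  unfolding poly_subst_def
proof (intro sum.cong refl arg_cong2[where f = "(*)"] prod.cong)
  fix m v
  assume "m \<in> Poly_Mapping.keys p" "v \<in> Poly_Mapping.keys m"
  then have "v \<in> S"
    using assms(1) by (auto simp: polys_in_def)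
  then show "s v ^ Poly_Mapping.lookup m v = t v ^ Poly_Mapping.lookup m v"
    by (simp add: assms(2))
qed

lemma poly_subst_closed:
  assumes "p \<in> polys_in S" "\<And>c. h c \<in> A" "\<And>v. v \<in> S \<Longrightarrow> s v \<in> A"
    and "0 \<in> A" "1 \<in> A" and "\<And>x y. x \<in> A \<Longrightarrow> y \<in> A \<Longrightarrow> x + y \<in> A"
    and mult: "\<And>x y. x \<in> A \<Longrightarrow> y \<in> A \<Longrightarrow> x * y \<in> A"
  shows "poly_subst h s p \<in> A"
proof -
  have sum: "(\<Sum>x\<in>B. g x) \<in> A" if "\<And>x. x \<in> B \<Longrightarrow> g x \<in> A" for B :: "(pvar \<Rightarrow>\<^sub>0 nat) set" and g
    using that by (induction B rule: infinite_finite_induct) (simp_all add: assms)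
  have prod: "(\<Prod>x\<in>B. g x) \<in> A" if "\<And>x. x \<in> B \<Longrightarrow> g x \<in> A" for B :: "pvar set" and g
    using that by (induction B rule: infinite_finite_induct) (simp_all add: assms)
  have pow: "x ^ k \<in> A" if "x \<in> A" for x and k :: nat
    using that by (induction k) (simp_all add: assms)
  show ?thesis
    unfolding poly_subst_def
  proof (intro sum mult prod pow)
    fix m v
    assume "m \<in> Poly_Mapping.keys p" "v \<in> Poly_Mapping.keys m"
    then show "s v \<in> A"
      using assms(1,3) by (auto simp: polys_in_def)
  qed (rule assms(2))
qed

lemma polys_in_0: "0 \<in> polys_in S" and polys_in_const: "const c \<in> polys_in S"
  and polys_in_var: "v \<in> S \<Longrightarrow> var v \<in> polys_in S"
  by (auto simp: polys_in_def const_def var_def)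

lemma polys_in_1: "1 \<in> polys_in S"
  using polys_in_const[of 1] by (simp add: const_1)

lemma polys_in_add: "p \<in> polys_in S \<Longrightarrow> q \<in> polys_in S \<Longrightarrow> p + q \<in> polys_in S"
  using keys_add[of p q] unfolding polys_in_def by blast

lemma polys_in_uminus: "p \<in> polys_in S \<Longrightarrow> - p \<in> polys_in S"
  by (simp add: polys_in_def)

lemma polys_in_diff: "p \<in> polys_in S \<Longrightarrow> q \<in> polys_in S \<Longrightarrow> p - q \<in> polys_in S"
  using polys_in_add[of p S "- q"] polys_in_uminus[of q S] by simp

lemma polys_in_mult:
  assumes "p \<in> polys_in S" "q \<in> polys_in S"
  shows "p * q \<in> polys_in S"
proof -
  have "Poly_Mapping.keys m \<subseteq> S" if "m \<in> Poly_Mapping.keys (p * q)" for m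
  proof -
    obtain m1 m2 where "m = m1 + m2" "m1 \<in> Poly_Mapping.keys p" "m2 \<in> Poly_Mapping.keys q"
      using \<open>m \<in> Poly_Mapping.keys (p * q)\<close> keys_mult[of p q] by blast
    then show ?thesis
      using assms keys_add[of m1 m2] unfolding polys_in_def by blast
  qed
  then show ?thesis
    by (simp add: polys_in_def)
qed

lemma polys_in_power: "p \<in> polys_in S \<Longrightarrow> p ^ k \<in> polys_in S"
  by (induction k) (simp_all add: polys_in_1 polys_in_mult)

lemma polys_in_sum: "(\<And>x. x \<in> A \<Longrightarrow> g x \<in> polys_in S) \<Longrightarrow> (\<Sum>x\<in>A. g x) \<in> polys_in S"
  by (induction A rule: infinite_finite_induct) (simp_all add: polys_in_0 polys_in_add)

lemma polys_in_mono: "S \<subseteq> T \<Longrightarrow> polys_in S \<subseteq> polys_in T"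
  by (auto simp: polys_in_def)

lemma polys_in_finite: "\<exists>S. finite S \<and> p \<in> polys_in S"
  by (rule exI[of _ "\<Union> (Poly_Mapping.keys ` Poly_Mapping.keys p)"]) (auto simp: polys_in_def)

lemma poly_subst_0_const: "poly_subst const (\<lambda>_. 0) p \<in> range const"
proof (rule poly_subst_closed[of p UNIV])
  fix x y :: "'a mpoly"
  assume "x \<in> range const" "y \<in> range const"
  then obtain c d where "x = const c" "y = const d"
    by blast
  then show "x + y \<in> range const" "x * y \<in> range const"
    by (simp_all flip: const_add const_mult)
next
  show "0 \<in> range const" "1 \<in> range const"
    by (metis const_0 rangeI) (metis const_1 rangeI)
qed (auto simp: polys_in_def intro: range_eqI[of _ _ 0] simp: const_0)

lemma polys_in_empty: "p \<in> polys_in {} \<Longrightarrow> p \<in> range const"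
  using poly_subst_cong[of p "{}" var "\<lambda>_. 0" const] poly_subst_0_const[of p]
  by (simp add: poly_subst_var)

section \<open>Total degree, and polynomials in one distinguished variable\<close>

text \<open>Each variable \<open>w\<close> becomes \<open>T * w\<close> for a new indeterminate
  \<open>T\<close>, so the degree in \<open>T\<close> is the total degree, additive under products
  as for univariate polynomials over a domain.\<close>

definition tpoly :: "'k::field mpoly \<Rightarrow> 'k mpoly poly" where
  "tpoly = poly_subst (\<lambda>c. [:const c:]) (\<lambda>w. [:0, var w:])"

definition tdeg :: "'k::field mpoly \<Rightarrow> nat" where
  "tdeg p = degree (tpoly p)"

lemma poly_tpoly: "poly (tpoly p) r = poly_subst const (\<lambda>w. r * var w) p"
  by (simp add: tpoly_def unital_ring_hom.map_poly_subst[OF unital_ring_hom_poly])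

lemma poly_tpoly_1: "poly (tpoly p) 1 = p"
  by (simp add: poly_tpoly poly_subst_var)

lemma tpoly_eq_0_iff: "tpoly p = 0 \<longleftrightarrow> p = 0"
  using poly_tpoly_1[of p] by (auto simp: tpoly_def pconst_hom.subst_0)

lemma tdeg_mult: "p \<noteq> 0 \<Longrightarrow> q \<noteq> 0 \<Longrightarrow> tdeg (p * q) = tdeg p + tdeg q"
  using tpoly_eq_0_iff[of p] tpoly_eq_0_iff[of q]
  by (simp add: tdeg_def tpoly_def pconst_hom.subst_mult degree_mult_eq)

lemma tdeg_0_const:
  assumes "tdeg p = 0"
  shows "p \<in> range const"
proof -
  obtain c where "tpoly p = [:c:]"
    using assms degree_eq_zeroE by (metis tdeg_def)
  \<comment> \<open>Putting \<open>T = 1\<close> returns \<open>p\<close>, and \<open>T = 0\<close>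
    kills all variables.\<close>
  then have "poly (tpoly p) 1 = poly (tpoly p) 0"
    by simp
  then show ?thesis
    using poly_subst_0_const[of p] unfolding poly_tpoly_1 by (simp add: poly_tpoly)
qed

lemma const_dvd_1: "c \<noteq> 0 \<Longrightarrow> const c dvd 1"
  by (rule dvdI[of _ _ "const (inverse c)"]) (simp flip: const_mult const_1)

lemma tdeg_0_dvd_1: "tdeg p = 0 \<Longrightarrow> p \<noteq> 0 \<Longrightarrow> p dvd 1"
  using tdeg_0_const[of p] by (auto simp: const_eq_0_iff intro: const_dvd_1)

text \<open>Induction on total degree: nonunit factors of a nonzero polynomial have positive degree,
  so each has smaller degree than the product.\<close>

lemma irreducible_divisor_exists:
  "p \<noteq> 0 \<Longrightarrow> \<not> p dvd 1 \<Longrightarrow> \<exists>r. irreducible r \<and> r dvd p" for p :: "'k::field mpoly"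
proof (induction "tdeg p" arbitrary: p rule: less_induct)
  case less
  show ?case
  proof (cases "irreducible p")
    case False
    then obtain a b where ab: "p = a * b" "\<not> a dvd 1" "\<not> b dvd 1"
      using less.prems unfolding irreducible_def by blast
    then have "a \<noteq> 0" "b \<noteq> 0"
      using less.prems by auto
    then have "tdeg a < tdeg p"
      using tdeg_mult tdeg_0_dvd_1 ab by fastforce
    then show ?thesis
      using less.hyps[of a] ab \<open>a \<noteq> 0\<close> by (metis dvd_mult2)
  qed (use dvd_refl in blast)
qed

text \<open>The indeterminate of the univariate polynomial takes the place of \<open>v\<close>. The
  coefficients keep the same type, so no ring in fewer variables has to be constructed.\<close>

definition vpoly :: "pvar \<Rightarrow> 'k::field mpoly \<Rightarrow> 'k mpoly poly" where
  "vpoly v = poly_subst (\<lambda>c. [:const c:]) (\<lambda>w. if w = v then [:0, 1:] else [:var w:])"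

lemma poly_vpoly: "poly (vpoly v p) r = poly_subst const (var(v := r)) p"
proof -
  have "poly (vpoly v p) r
      = poly_subst const (\<lambda>w. poly (if w = v then [:0, 1:] else [:var w:]) r) p"
    by (simp add: vpoly_def unital_ring_hom.map_poly_subst[OF unital_ring_hom_poly])
  also have "(\<lambda>w. poly (if w = v then [:0, 1:] else [:var w:]) r) = var(v := r)"
    by auto
  finally show ?thesis .
qed

lemma poly_vpoly_var: "poly (vpoly v p) (var v) = p"
  by (simp add: poly_vpoly poly_subst_var)

lemma vpoly_eq_0_iff: "vpoly v p = 0 \<longleftrightarrow> p = 0"
  using poly_vpoly_var[of v p] by (auto simp: vpoly_def pconst_hom.subst_0)

lemma vpoly_mult: "vpoly v (p * q) = vpoly v p * vpoly v q"
  and vpoly_diff: "vpoly v (p - q) = vpoly v p - vpoly v q"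
  by (simp_all add: vpoly_def pconst_hom.subst_mult pconst_hom.subst_diff)

lemma vpoly_power_var: "vpoly v (var v ^ k) = monom 1 k"
  by (simp add: vpoly_def pconst_hom.subst_power pconst_hom.subst_var monom_altdef)

lemma vpoly_free:
  assumes "p \<in> polys_in S" "v \<notin> S"
  shows "vpoly v p = [:p:]"
proof -
  have "vpoly v p = poly_subst (\<lambda>c. [:const c:]) (\<lambda>w. [:var w:]) p"
    unfolding vpoly_def using assms by (intro poly_subst_cong) auto
  also have "\<dots> = [:poly_subst const var p:]"
    by (simp add: unital_ring_hom.map_poly_subst[OF unital_ring_hom_pCons])
  finally show ?thesis
    by (simp add: poly_subst_var)
qed

lemma coeff_vpoly_polys_in:
  assumes "p \<in> polys_in (insert v S)"
  shows "coeff (vpoly v p) i \<in> polys_in S"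
proof -
  have "vpoly v p \<in> {P. \<forall>i. coeff P i \<in> polys_in S}"
    unfolding vpoly_def
  proof (rule poly_subst_closed[OF assms])
    fix w
    assume "w \<in> insert v S"
    then show "(if w = v then [:0, 1:] else [:var w:]) \<in> {P. \<forall>i. coeff P i \<in> polys_in S}"
      by (auto simp: coeff_pCons polys_in_0 polys_in_1 polys_in_var split: nat.split)
  qed (auto simp: coeff_pCons coeff_mult polys_in_0 polys_in_1 polys_in_const polys_in_add
      intro!: polys_in_sum polys_in_mult split: nat.split)
  then show ?thesis
    by blast
qed

lemma vpoly_degree_0:
  assumes "degree (vpoly v p) = 0" "p \<in> polys_in (insert v S)"
  shows "p \<in> polys_in S"
proof -
  obtain c where c: "vpoly v p = [:c:]"
    using assms(1) degree_eq_zeroE by blast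
  then have "c = p"
    using poly_vpoly_var[of v p] by simp
  then show ?thesis
    using coeff_vpoly_polys_in[OF assms(2), of 0] c by simp
qed

text \<open>For each \<open>v\<close> outside \<open>S\<close> the degrees of the two factors in
  \<open>v\<close> add up to 0, so both are free of \<open>v\<close>.\<close>

lemma polys_in_dvd:
  assumes "p * q \<in> polys_in S" "p * q \<noteq> 0"
  shows "p \<in> polys_in S"
proof -
  have "p \<in> polys_in (- {v})" if "v \<notin> S" for v
  proof (rule vpoly_degree_0)
    have "degree (vpoly v p) + degree (vpoly v q) = degree (vpoly v (p * q))"
      using assms(2) by (simp add: vpoly_mult degree_mult_eq vpoly_eq_0_iff)
    also have "\<dots> = 0"
      using vpoly_free[OF assms(1) that] by simp
    finally show "degree (vpoly v p) = 0"
      by simp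
  qed (auto simp: polys_in_def)
  then show ?thesis
    by (auto simp: polys_in_def)
qed

section \<open>Irreducible polynomials are prime\<close>

text \<open>
  Induction on the set of variables, without passing to a fraction field: if \<open>a\<close> is
  irreducible of positive degree in the new variable and does not divide \<open>b\<close>, then the ideal
  \<open>(a, b)\<close> contains a nonzero polynomial in the old variables only.
\<close>

definition irreducibles_prime_in :: "'k::field itself \<Rightarrow> pvar set \<Rightarrow> bool" where
  "irreducibles_prime_in _ S \<longleftrightarrow>
    (\<forall>r b c :: 'k mpoly. r \<in> polys_in S \<longrightarrow> b \<in> polys_in S \<longrightarrow> c \<in> polys_in S \<longrightarrow>
      irreducible r \<longrightarrow> r dvd b * c \<longrightarrow> r dvd b \<or> r dvd c)"

section \<open>Gauss's lemma: irreducibles free of the new variable remain prime\<close>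

lemma dvd_vpoly_iff:
  assumes "r \<in> polys_in S" "v \<notin> S"
  shows "r dvd p \<longleftrightarrow> [:r:] dvd vpoly v p"
proof
  assume "r dvd p"
  then show "[:r:] dvd vpoly v p"
    by (metis dvd_def vpoly_free[OF assms] vpoly_mult)
next
  assume "[:r:] dvd vpoly v p"
  then obtain Q where "vpoly v p = [:r:] * Q"
    by (elim dvdE)
  then have "p = r * poly Q (var v)"
    using poly_vpoly_var[of v p] by simp
  then show "r dvd p"
    by simp
qed

text \<open>With \<open>i\<close> and \<open>j\<close> the least indices of coefficients of
  \<open>E\<close> and \<open>H\<close> that \<open>r\<close> does not divide, all terms but one of
  coefficient \<open>i + j\<close> of \<open>E * H\<close> are divisible by \<open>r\<close>, so the
  prime \<open>r\<close> would divide the remaining product.\<close>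

lemma const_poly_dvd_mult:
  fixes E H :: "'k::field mpoly poly"
  assumes "irreducibles_prime_in TYPE('k) S" "irreducible r" "r \<in> polys_in S"
    and "\<And>i. coeff E i \<in> polys_in S" "\<And>i. coeff H i \<in> polys_in S" "[:r:] dvd E * H"
  shows "[:r:] dvd E \<or> [:r:] dvd H"
proof (rule ccontr)
  assume "\<not> ?thesis"
  then have ex: "\<exists>i. \<not> r dvd coeff E i" "\<exists>i. \<not> r dvd coeff H i"
    by (auto simp: const_poly_dvd_iff)
  define i j where "i = (LEAST i. \<not> r dvd coeff E i)" and "j = (LEAST j. \<not> r dvd coeff H j)"
  have i: "\<not> r dvd coeff E i" "\<And>k. k < i \<Longrightarrow> r dvd coeff E k"
    and j: "\<not> r dvd coeff H j" "\<And>k. k < j \<Longrightarrow> r dvd coeff H k"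
    unfolding i_def j_def using LeastI_ex[OF ex(1)] LeastI_ex[OF ex(2)] not_less_Least by blast+
  have "coeff (E * H) (i + j) = (\<Sum>k\<le>i + j. coeff E k * coeff H (i + j - k))"
    by (simp add: coeff_mult)
  also have "\<dots> = coeff E i * coeff H j + (\<Sum>k\<in>{..i + j} - {i}. coeff E k * coeff H (i + j - k))"
    by (subst sum.remove[of _ i]) auto
  finally have split: "coeff (E * H) (i + j)
      = coeff E i * coeff H j + (\<Sum>k\<in>{..i + j} - {i}. coeff E k * coeff H (i + j - k))" .
  have "r dvd (\<Sum>k\<in>{..i + j} - {i}. coeff E k * coeff H (i + j - k))"
  proof (rule dvd_sum)
    fix k
    assume "k \<in> {..i + j} - {i}"
    \<comment> \<open>If \<open>k > i\<close>, then \<open>k \<le> i + j\<close> keeps the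
      subtraction exact and the other index lies below \<open>j\<close>.\<close>
    then consider "k < i" | "i + j - k < j"
      by fastforce
    then show "r dvd coeff E k * coeff H (i + j - k)"
      by cases (use i(2) j(2) in auto)
  qed
  moreover have "r dvd coeff (E * H) (i + j)"
    using assms(6) by (simp add: const_poly_dvd_iff)
  ultimately have "r dvd coeff E i * coeff H j"
    unfolding split using dvd_add_left_iff by blast
  then show False
    using assms(1-5) i(1) j(1) unfolding irreducibles_prime_in_def by blast
qed

lemma irreducible_dvd_mult_insert:
  fixes r :: "'k::field mpoly"
  assumes "irreducibles_prime_in TYPE('k) S" "v \<notin> S" "irreducible r" "r \<in> polys_in S"
    and "e \<in> polys_in (insert v S)" "h \<in> polys_in (insert v S)" "r dvd e * h"
  shows "r dvd e \<or> r dvd h"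
  using const_poly_dvd_mult[OF assms(1,3,4), of "vpoly v e" "vpoly v h"] assms
  by (simp add: dvd_vpoly_iff[OF assms(4,2)] vpoly_mult coeff_vpoly_polys_in)

text \<open>This is the decrease in the inductions below that strip one irreducible factor at a
  time.\<close>

lemma tdeg_irreducible_mult_less:
  assumes "irreducible r" "s \<noteq> 0"
  shows "tdeg s < tdeg (r * s)"
proof -
  have "r \<noteq> 0" "\<not> r dvd 1"
    using assms(1) by (auto simp: irreducible_def)
  then have "tdeg r \<noteq> 0"
    using tdeg_0_dvd_1 by blast
  then show ?thesis
    using \<open>r \<noteq> 0\<close> assms(2) by (simp add: tdeg_mult)
qed

text \<open>The irreducible factors of \<open>s\<close> are cancelled one by one: each is prime by
  Gauss's lemma and does not divide the primitive \<open>a\<close>, so it divides the cofactor of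
  \<open>a\<close>.\<close>

lemma primitive_dvd_cancel:
  fixes a :: "'k::field mpoly"
  assumes "irreducibles_prime_in TYPE('k) S" "v \<notin> S"
    and "a \<in> polys_in (insert v S)" "\<And>r. r \<in> polys_in S \<Longrightarrow> irreducible r \<Longrightarrow> \<not> r dvd a"
    and "b \<in> polys_in (insert v S)"
  shows "s \<in> polys_in S \<Longrightarrow> s \<noteq> 0 \<Longrightarrow> a dvd s * b \<Longrightarrow> a dvd b"
proof (induction "tdeg s" arbitrary: s rule: less_induct)
  case less
  show ?case
  proof (cases "s dvd 1")
    case True
    then obtain u where "1 = s * u"
      by blast
    then have "b = (s * b) * u"
      by (metis mult.assoc mult.commute mult_1)
    then show ?thesis
      using less.prems(3) by (metis dvd_mult2)
  next
    case False
    then obtain r where r: "irreducible r" "r dvd s"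
      using irreducible_divisor_exists less.prems(2) by blast
    then obtain s' where s: "s = r * s'"
      by blast
    then have S: "r \<in> polys_in S" "s' \<in> polys_in S" "s' \<noteq> 0"
      using less.prems polys_in_dvd[of r s' S] polys_in_dvd[of s' r S] by (auto simp: mult.commute)
    obtain g where g: "s * b = a * g"
      using less.prems(3) by blast
    show ?thesis
    proof (cases "b = 0")
      case False
      then have "a * g \<in> polys_in (insert v S)" "a * g \<noteq> 0"
        using g less.prems assms(5) polys_in_mono[of S "insert v S"]
        by (auto simp flip: g intro!: polys_in_mult)
      then have "g \<in> polys_in (insert v S)"
        by (metis mult.commute polys_in_dvd)
      moreover have "r dvd a * g"
        by (simp flip: g add: s)
      ultimately have "r dvd g"
        using irreducible_dvd_mult_insert[OF assms(1,2) r(1) S(1) assms(3)] assms(4) S(1) r(1) by blast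
      then obtain g' where "g = r * g'"
        by blast
      then have "r * (s' * b) = r * (a * g')"
        using g s by (simp add: ac_simps)
      then have "s' * b = a * g'"
        using r(1) by (auto simp: irreducible_def)
      then have "a dvd s' * b"
        by simp
      then show ?thesis
        using less.hyps[of s'] S s tdeg_irreducible_mult_less[OF r(1) S(3)] by blast
    qed simp
  qed
qed

text \<open>Each irreducible factor of \<open>s\<close> divides \<open>e\<close> or \<open>h\<close>
  and is cancelled there. Those taken from \<open>e\<close> make up \<open>s'\<close>, and the unit
  left over from \<open>s\<close> goes into \<open>h'\<close>.\<close>

lemma factor_out_scalar:
  fixes a :: "'k::field mpoly"
  assumes "irreducibles_prime_in TYPE('k) S" "v \<notin> S"
  shows "s \<in> polys_in S \<Longrightarrow> s \<noteq> 0 \<Longrightarrow> e \<in> polys_in (insert v S) \<Longrightarrow> h \<in> polys_in (insert v S)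
    \<Longrightarrow> e * h = s * a \<Longrightarrow> e \<noteq> 0 \<Longrightarrow> \<exists>s' e' h'. s' \<in> polys_in S \<and> e = s' * e' \<and> a = e' * h'"
proof (induction "tdeg s" arbitrary: s e h rule: less_induct)
  case less
  show ?case
  proof (cases "s dvd 1")
    case True
    then obtain u where "1 = s * u"
      by blast
    then have "a = e * (h * u)"
      using less.prems(5) by (metis mult.assoc mult.commute mult.right_neutral)
    then show ?thesis
      using polys_in_1 by (metis mult_1)
  next
    case False
    then obtain r where r: "irreducible r" "r dvd s"
      using irreducible_divisor_exists less.prems(2) by blast
    then obtain s' where s: "s = r * s'"
      by blast
    then have S: "r \<in> polys_in S" "s' \<in> polys_in S" "s' \<noteq> 0"
      using less.prems polys_in_dvd[of r s' S] polys_in_dvd[of s' r S] by (auto simp: mult.commute)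
    have r0: "r \<noteq> 0"
      using r(1) by (auto simp: irreducible_def)
    have less: "tdeg s' < tdeg s"
      using s tdeg_irreducible_mult_less[OF r(1) S(3)] by simp
    have "r dvd e * h"
      unfolding less.prems(5) s by simp
    then consider "r dvd e" | "r dvd h"
      using irreducible_dvd_mult_insert[OF assms r(1) S(1) less.prems(3,4)] by blast
    then show ?thesis
    proof cases
      case 1
      then obtain e1 where e: "e = r * e1"
        by blast
      moreover have "e1 \<in> polys_in (insert v S)"
        using e less.prems(3,6) polys_in_dvd[of e1 r] by (simp add: mult.commute)
      moreover have "r * (e1 * h) = r * (s' * a)"
        using less.prems(5) e s by (simp add: ac_simps)
      ultimately obtain s1 e' h' where "s1 \<in> polys_in S" "e1 = s1 * e'" "a = e' * h'"
        using less.hyps[OF less S(2,3) _ less.prems(4), of e1] less.prems(6) r0 by force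
      then show ?thesis
        using e S(1) by (metis mult.assoc polys_in_mult)
    next
      case 2
      then obtain h1 where h: "h = r * h1"
        by blast
      moreover have "h1 \<in> polys_in (insert v S)"
        using h less.prems(4) polys_in_dvd[of h1 r] polys_in_0 by (cases "h1 = 0") (simp_all add: mult.commute r0)
      moreover have "r * (e * h1) = r * (s' * a)"
        using less.prems(5) h s by (simp add: ac_simps)
      ultimately show ?thesis
        using less.hyps[OF less S(2,3) less.prems(3)] less.prems(6) r0 by auto
    qed
  qed
qed

text \<open>
  Pseudo-division by an element of minimal degree in \<open>v\<close> of an ideal leaves no remainder.
\<close>

lemma minimal_pseudo_dvd:
  fixes e :: "'k::field mpoly"
  assumes "v \<notin> S" "I \<subseteq> polys_in (insert v S)" "e \<in> I" "e \<noteq> 0"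
    and minimal: "\<And>x. x \<in> I \<Longrightarrow> x \<noteq> 0 \<Longrightarrow> degree (vpoly v e) \<le> degree (vpoly v x)"
    and ideal: "\<And>x y c d. x \<in> I \<Longrightarrow> y \<in> I \<Longrightarrow> c \<in> polys_in (insert v S) \<Longrightarrow> d \<in> polys_in (insert v S)
      \<Longrightarrow> c * x - d * y \<in> I"
  shows "x \<in> I \<Longrightarrow> \<exists>s \<in> polys_in S. s \<noteq> 0 \<and> e dvd s * x"
proof (induction "degree (vpoly v x)" arbitrary: x rule: less_induct)
  case less
  let ?deg = "\<lambda>p. degree (vpoly v p)"
  let ?lc = "\<lambda>p. lead_coeff (vpoly v p)"
  show ?case
  proof (cases "x = 0")
    case True
    then show ?thesis
      using polys_in_1 by (intro bexI[of _ 1]) auto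
  next
    case False
    have le: "?deg e \<le> ?deg x"
      using minimal less.prems False by blast
    have lc: "?lc e \<in> polys_in S" "?lc x \<in> polys_in S"
      using assms(2,3) less.prems coeff_vpoly_polys_in by blast+
    \<comment> \<open>Cross-multiplying by leading coefficients cancels the leading term in
      \<open>v\<close>: one step of pseudo-division, which stays in \<open>I\<close>.\<close>
    define y where "y = ?lc e * x - (?lc x * var v ^ (?deg x - ?deg e)) * e"
    have "y \<in> I"
      unfolding y_def using lc polys_in_mono[of S "insert v S"]
      by (intro ideal less.prems assms(3) polys_in_mult polys_in_power polys_in_var) auto
    have y: "vpoly v y = smult (?lc e) (vpoly v x) - smult (?lc x) (monom 1 (?deg x - ?deg e) * vpoly v e)"
      by (simp add: y_def vpoly_diff vpoly_mult vpoly_free[OF lc(1) assms(1)]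
          vpoly_free[OF lc(2) assms(1)] vpoly_power_var mult.assoc)
    have lcx: "?lc e \<noteq> 0"
      using assms(4) by (simp add: vpoly_eq_0_iff)
    \<comment> \<open>The polynomial 0 also has degree 0, so when \<open>x\<close> has degree 0 in
      \<open>v\<close> the remainder can only vanish, not drop in degree.\<close>
    have "y = 0 \<or> ?deg y < ?deg x"
    proof (cases "y = 0")
      case False
      have "?deg y \<le> ?deg x"
        unfolding y using le
        by (intro degree_diff_le order.trans[OF degree_smult_le] order.trans[OF degree_mult_le])
          (auto simp: degree_monom_eq)
      moreover have "coeff (vpoly v y) (?deg x) = 0"
        unfolding y using le by (simp add: coeff_monom_mult)
      then have "?deg y \<noteq> ?deg x"
        using False by (metis leading_coeff_0_iff vpoly_eq_0_iff)
      ultimately show ?thesis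
        by linarith
    qed blast
    then obtain s where s: "s \<in> polys_in S" "s \<noteq> 0" "e dvd s * y"
      using less.hyps[of y] \<open>y \<in> I\<close> polys_in_1[of S] by (metis dvd_0_right mult_zero_right one_neq_zero)
    have "(s * ?lc e) * x = s * y + (s * (?lc x * var v ^ (?deg x - ?deg e))) * e"
      by (simp add: y_def algebra_simps)
    then have "e dvd (s * ?lc e) * x"
      using s(3) by simp
    then show ?thesis
      using s lc lcx polys_in_mult by (intro bexI[of _ "s * ?lc e"]) auto
  qed
qed

text \<open>An element \<open>e\<close> of least degree in \<open>v\<close> in the ideal
  \<open>(a, b)\<close> plays the role of a gcd over the field of fractions of the old polynomials:
  degree 0 means that \<open>a\<close> and \<open>b\<close> are coprime there and leads to
  \<open>a dvd c\<close>; positive degree leads to \<open>a dvd b\<close>.\<close>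

lemma irreducibles_prime_in_insert:
  assumes ih: "irreducibles_prime_in TYPE('k::field) S" and v: "v \<notin> S"
  shows "irreducibles_prime_in TYPE('k) (insert v S)"
  unfolding irreducibles_prime_in_def
proof (intro allI impI)
  let ?U = "polys_in (insert v S)"
  let ?deg = "\<lambda>p. degree (vpoly v p)"
  fix a b c :: "'k mpoly"
  assume U: "a \<in> ?U" "b \<in> ?U" "c \<in> ?U" and irr: "irreducible a" and dvd: "a dvd b * c"
  have a0: "a \<noteq> 0"
    using irr by (auto simp: irreducible_def)
  show "a dvd b \<or> a dvd c"
  proof (cases "?deg a = 0")
    case True
    then show ?thesis
      using irreducible_dvd_mult_insert[OF ih v irr _ U(2,3) dvd] vpoly_degree_0 U(1) by blast
  next
    case False
    have unit_deg: "?deg u = 0" if "u dvd 1" for u :: "'k mpoly"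
    proof -
      obtain w where "1 = u * w"
        using \<open>u dvd 1\<close> by blast
      then have "[:1:] = vpoly v u * vpoly v w"
        using vpoly_free[OF polys_in_1 v] by (metis vpoly_mult)
      moreover from this have "vpoly v u \<noteq> 0" "vpoly v w \<noteq> 0"
        by auto
      ultimately have "degree [:1 :: 'k mpoly:] = ?deg u + ?deg w"
        by (simp add: degree_mult_eq)
      then show ?thesis
        by simp
    qed
    \<comment> \<open>An irreducible factor free of \<open>v\<close> would leave a unit as cofactor,
      and \<open>a\<close> would have degree 0 in \<open>v\<close>.\<close>
    have prim: "\<And>r. r \<in> polys_in S \<Longrightarrow> irreducible r \<Longrightarrow> \<not> r dvd a"
    proof
      fix r
      assume that: "r \<in> polys_in S" "irreducible r" and "r dvd a"
      then obtain k where k: "a = r * k"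
        by blast
      then have "k dvd 1"
        using irr that(2) unfolding irreducible_def by blast
      then have "?deg a = 0"
        using k a0 vpoly_free[OF that(1) v] unit_deg[of k]
        by (simp add: vpoly_mult degree_mult_eq vpoly_eq_0_iff)
      then show False
        using False by blast
    qed
    have cancel: "a dvd y" if "y \<in> ?U" "s \<in> polys_in S" "s \<noteq> 0" "a dvd s * y" for s y
      using prim by (rule primitive_dvd_cancel[OF ih v U(1) _ that])
    define I where "I = {u * a + w * b | u w. u \<in> ?U \<and> w \<in> ?U}"
    have I: "I \<subseteq> ?U" "a \<in> I" "b \<in> I"
    proof -
      show "I \<subseteq> ?U"
        using U by (auto simp: I_def intro!: polys_in_add polys_in_mult)
      have "a = 1 * a + 0 * b" "b = 0 * a + 1 * b"
        by simp_all
      then show "a \<in> I" "b \<in> I"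
        unfolding I_def using polys_in_0 polys_in_1 by blast+
    qed
    have ideal: "c1 * x - c2 * y \<in> I" if "x \<in> I" "y \<in> I" "c1 \<in> ?U" "c2 \<in> ?U" for x y c1 c2
    proof -
      obtain u1 w1 u2 w2 where "x = u1 * a + w1 * b" "y = u2 * a + w2 * b"
        and *: "u1 \<in> ?U" "w1 \<in> ?U" "u2 \<in> ?U" "w2 \<in> ?U"
        using \<open>x \<in> I\<close> \<open>y \<in> I\<close> by (auto simp: I_def)
      then have "c1 * x - c2 * y = (c1 * u1 - c2 * u2) * a + (c1 * w1 - c2 * w2) * b"
        by (simp add: algebra_simps)
      moreover have "c1 * u1 - c2 * u2 \<in> ?U" "c1 * w1 - c2 * w2 \<in> ?U"
        using * that by (auto intro!: polys_in_diff polys_in_mult)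
      ultimately show ?thesis
        unfolding I_def by blast
    qed
    obtain e where e: "e \<in> I" "e \<noteq> 0" and min: "\<And>x. x \<in> I \<Longrightarrow> x \<noteq> 0 \<Longrightarrow> ?deg e \<le> ?deg x"
      using ex_has_least_nat[of "\<lambda>x. x \<in> I \<and> x \<noteq> 0" a ?deg] I(2) a0 by blast
    have pseudo: "\<exists>s \<in> polys_in S. s \<noteq> 0 \<and> e dvd s * x" if "x \<in> I" for x
      using min ideal that by (rule minimal_pseudo_dvd[OF v I(1) e])
    have eU: "e \<in> ?U"
      using e(1) I(1) by blast
    show ?thesis
    proof (cases "?deg e = 0")
      case True
      obtain u w where "e = u * a + w * b"
        using e(1) by (auto simp: I_def)
      \<comment> \<open>Multiplying the Bezout relation by \<open>c\<close> puts the known multiple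
        \<open>b * c\<close> of \<open>a\<close> in place of \<open>b\<close>.\<close>
      then have "e * c = a * (u * c) + w * (b * c)"
        by (simp add: algebra_simps)
      then have "a dvd e * c"
        using dvd by simp
      then show ?thesis
        using cancel[OF U(3) _ e(2)] vpoly_degree_0[OF True eU] by blast
    next
      case False
      \<comment> \<open>\<open>e\<close> divides \<open>a\<close> up to a factor free of
        \<open>v\<close>; removing that factor yields a true factorization of \<open>a\<close>, to
        which irreducibility applies.\<close>
      obtain s h where s: "s \<in> polys_in S" "s \<noteq> 0" "e * h = s * a"
        using pseudo[OF I(2)] by (metis dvd_def)
      have "s * a \<in> ?U" "s * a \<noteq> 0"
        using s(1,2) a0 U(1) polys_in_mono[of S "insert v S"] by (auto intro!: polys_in_mult)
      then have "h \<in> ?U"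
        using polys_in_dvd[of h e] s(3) by (simp add: mult.commute)
      obtain s1 e' h' where e': "s1 \<in> polys_in S" "e = s1 * e'" "a = e' * h'"
        using factor_out_scalar[OF ih v s(1,2) eU \<open>h \<in> ?U\<close> s(3) e(2)] by blast
      \<comment> \<open>As \<open>s1\<close> is free of \<open>v\<close>, \<open>e'\<close> carries
        the whole positive degree of \<open>e\<close> in \<open>v\<close>.\<close>
      have "?deg e = ?deg s1 + ?deg e'"
        using e' e(2) by (simp add: vpoly_mult degree_mult_eq vpoly_eq_0_iff)
      then have "\<not> e' dvd 1"
        using unit_deg False vpoly_free[OF e'(1) v] by auto
      then have "h' dvd 1"
        using irr e'(3) unfolding irreducible_def by blast
      then obtain u where "1 = h' * u"
        by blast
      then have "e = a * (u * s1)"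
        unfolding e'(2,3) by (metis mult.assoc mult.commute mult_1)
      then have "a dvd e"
        by simp
      moreover obtain t where "t \<in> polys_in S" "t \<noteq> 0" "e dvd t * b"
        using pseudo[OF I(3)] by blast
      ultimately show ?thesis
        using cancel[OF U(2)] dvd_trans by blast
    qed
  qed
qed

lemma irreducibles_prime_in_finite: "finite S \<Longrightarrow> irreducibles_prime_in TYPE('k::field) S"
proof (induction S rule: finite_induct)
  case empty
  \<comment> \<open>Without variables all polynomials are constants, hence 0 or units.\<close>
  have "\<not> irreducible r" if "r \<in> polys_in {}" for r :: "'k mpoly"
    using polys_in_empty[OF that] const_dvd_1 by (auto simp: irreducible_def const_eq_0_iff)
  then show ?case
    by (simp add: irreducibles_prime_in_def)
qed (rule irreducibles_prime_in_insert)

section \<open>Primality in the full ring, coprimality and lowest terms\<close>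

lemma irreducible_dvd_mult:
  fixes r :: "'k::field mpoly"
  assumes "irreducible r" "r dvd b * c"
  shows "r dvd b \<or> r dvd c"
proof -
  \<comment> \<open>Three polynomials involve only finitely many variables, which brings them into
    reach of the induction over finite variable sets.\<close>
  obtain R B C where *: "finite R" "r \<in> polys_in R" "finite B" "b \<in> polys_in B" "finite C" "c \<in> polys_in C"
    using polys_in_finite by metis
  let ?S = "R \<union> B \<union> C"
  have "r \<in> polys_in ?S" "b \<in> polys_in ?S" "c \<in> polys_in ?S"
    using * polys_in_mono[of R ?S] polys_in_mono[of B ?S] polys_in_mono[of C ?S] by blast+
  then show ?thesis
    using irreducibles_prime_in_finite[of ?S] * assms unfolding irreducibles_prime_in_def by blast
qed

text \<open>An irreducible factor \<open>r\<close> of \<open>b\<close> cannot divide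
  \<open>a\<close>, so being prime it divides \<open>c\<close>; cancelling it from \<open>b\<close>
  and \<open>c\<close> lowers the degree of \<open>b\<close>.\<close>

lemma coprime_dvd_mult:
  fixes a :: "'k::field mpoly"
  shows "b \<noteq> 0 \<Longrightarrow> (\<And>d. d dvd a \<Longrightarrow> d dvd b \<Longrightarrow> d dvd 1) \<Longrightarrow> b dvd a * c \<Longrightarrow> b dvd c"
proof (induction "tdeg b" arbitrary: b c rule: less_induct)
  case less
  show ?case
  proof (cases "b dvd 1")
    case True
    then show ?thesis
      by (meson dvd_trans one_dvd)
  next
    case False
    then obtain r b' where r: "irreducible r" and b: "b = r * b'"
      using irreducible_divisor_exists less.prems(1) by blast
    then have "\<not> r dvd a"
      using less.prems(2)[of r] by (auto simp: irreducible_def)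
    moreover have "r dvd a * c"
      using less.prems(3) b dvd_mult_left by blast
    ultimately obtain c' where c: "c = r * c'"
      using irreducible_dvd_mult[OF r] by blast
    have "r \<noteq> 0"
      using r by (auto simp: irreducible_def)
    then have "b' dvd a * c'"
      using less.prems(3) b c by (simp add: mult.left_commute)
    moreover have "b' \<noteq> 0" "tdeg b' < tdeg b"
      using less.prems(1) b tdeg_irreducible_mult_less[OF r] by auto
    moreover have "d dvd 1" if "d dvd a" "d dvd b'" for d
      using less.prems(2) that b by simp
    ultimately have "b' dvd c'"
      using less.hyps by blast
    then show ?thesis
      by (simp add: b c)
  qed
qed

text \<open>A fraction whose denominator has least total degree will do, since cancelling a nonunit
  common divisor would lower that degree.\<close>

lemma lowest_terms_exists:
  assumes "q \<in> rat_field n"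
  shows "\<exists>a b. lowest_terms n q a b"
proof -
  let ?P = "\<lambda>x. fst x \<in> poly_ring n \<and> snd x \<in> poly_ring n \<and> snd x \<noteq> 0 \<and> q = Fract (fst x) (snd x)"
  obtain a0 b0 where "?P (a0, b0)"
    using assms by (auto simp: rat_field_def)
  from ex_has_least_nat[of ?P, OF this, of "\<lambda>x. tdeg (snd x)"]
  obtain x where x: "?P x" and least: "\<forall>y. ?P y \<longrightarrow> tdeg (snd x) \<le> tdeg (snd y)"
    by blast
  obtain a b where x_eq: "x = (a, b)"
    by fastforce
  have ab: "?P (a, b)" and min: "\<And>y. ?P y \<Longrightarrow> tdeg b \<le> tdeg (snd y)"
    using x least unfolding x_eq snd_conv by blast+
  have "c dvd 1" if "c dvd a" "c dvd b" for c
  proof -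
    obtain a' b' where c: "a = c * a'" "b = c * b'"
      using \<open>c dvd a\<close> \<open>c dvd b\<close> by blast
    then have nz: "c \<noteq> 0" "b' \<noteq> 0"
      using ab by auto
    have "a' \<in> poly_ring n" "b' \<in> poly_ring n"
      using ab nz polys_in_dvd[of a' c] polys_in_dvd[of b' c] polys_in_0[of "pvars n"]
      unfolding c poly_ring_eq_polys_in by (auto simp: mult.commute)
    moreover have "q = Fract a' b'"
      using ab nz unfolding c by (simp add: eq_fract)
    ultimately have "tdeg b \<le> tdeg b'"
      using min[of "(a', b')"] nz by simp
    then show ?thesis
      using nz tdeg_mult[of c b'] tdeg_0_dvd_1[of c] by (simp add: c)
  qed
  then show ?thesis
    using ab by (auto simp: lowest_terms_def)
qed

section \<open>The generic matrix\<close>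

text \<open>The variables in \<open>V\<close> are specialized one at a time. In each step the bad
  values are roots of a nonzero univariate polynomial over a domain, and finitely many roots cannot
  exhaust infinitely many constants.\<close>

lemma nonzero_specialization:
  fixes p :: "'k::field mpoly"
  assumes "infinite (UNIV :: 'k set)" "finite V" "p \<noteq> 0"
  shows "\<exists>c :: pvar \<Rightarrow> 'k. poly_subst const (\<lambda>u. if u \<in> V then const (c u) else var u) p \<noteq> 0"
  using assms(2)
proof (induction V rule: finite_induct)
  case empty
  then show ?case
    using assms(3) by (simp add: poly_subst_var)
next
  case (insert v V)
  then obtain c :: "pvar \<Rightarrow> 'k"
    where c: "poly_subst const (\<lambda>u. if u \<in> V then const (c u) else var u) p \<noteq> 0" (is "?p \<noteq> 0")
    by blast
  have "finite {x. poly (vpoly v ?p) x = 0}"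
    using c by (intro poly_roots_finite) (simp add: vpoly_eq_0_iff)
  moreover have "infinite (range (const :: 'k \<Rightarrow> 'k mpoly))"
    using assms(1) by (simp add: finite_image_iff inj_def const_inject)
  ultimately have "\<not> range const \<subseteq> {x. poly (vpoly v ?p) x = 0}"
    using finite_subset by blast
  then obtain d :: 'k where "poly (vpoly v ?p) (const d) \<noteq> 0"
    by blast
  moreover have "poly (vpoly v ?p) (const d)
      = poly_subst const (\<lambda>u. if u \<in> insert v V then const ((c(v := d)) u) else var u) p"
    unfolding poly_vpoly const_hom.subst_comp
    by (rule arg_cong[where f = "\<lambda>s. poly_subst const s p"])
      (use insert.hyps in \<open>auto simp: const_hom.subst_const const_hom.subst_var\<close>)
  ultimately show ?case
    by (intro exI[of _ "c(v := d)"]) simp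
qed

text \<open>
  The entries of a generic matrix are four variables that do not occur in \<open>pvars n\<close>.
\<close>

fun generic_images :: "nat \<Rightarrow> pvar \<Rightarrow> 'k::field mpoly" where
  "generic_images n (X i) = var (X 0) * var (X i) + var (Y 0) * var (Y i)"
| "generic_images n (Y i) = var (X (Suc n)) * var (X i) + var (Y (Suc n)) * var (Y i)"

abbreviation generic_act :: "nat \<Rightarrow> 'k::field mpoly \<Rightarrow> 'k mpoly" where
  "generic_act n \<equiv> poly_subst const (generic_images n)"

lemma det_poly_nonzero:
  assumes "i \<noteq> j"
  shows "var (X i) * var (Y j) - var (Y i) * var (X j) \<noteq> (0 :: 'k::field mpoly)"
proof
  assume "var (X i) * var (Y j) - var (Y i) * var (X j) = (0 :: 'k mpoly)"
  \<comment> \<open>At this point the determinant is 1, because \<open>i\<close> and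
    \<open>j\<close> differ.\<close>
  then have "poly_subst const (\<lambda>v. if v = X i \<or> v = Y j then 1 else 0 :: 'k mpoly)
      (var (X i) * var (Y j) - var (Y i) * var (X j)) = 0"
    by (simp add: const_hom.subst_0)
  then show False
    using assms by (simp add: const_hom.subst_diff const_hom.subst_mult const_hom.subst_var)
qed

text \<open>If the identity failed, the generic entries could be specialized in the infinite field
  to an invertible matrix \<open>G\<close> for which it still fails, although \<open>G\<close> fixes
  \<open>q\<close>.\<close>

lemma generic_invariance:
  fixes q :: "'k::field ratfun"
  assumes inf: "infinite (UNIV :: 'k set)" and q: "q \<in> gl2_invariants n" "q = Fract a b"
    and ab: "a \<in> poly_ring n" "b \<in> poly_ring n" "b \<noteq> 0"
  shows "a * generic_act n b = generic_act n a * b"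
proof (rule ccontr)
  assume neq: "a * generic_act n b \<noteq> generic_act n a * b"
  \<comment> \<open>\<open>?D\<close> is the determinant of the generic matrix; as a factor of
    \<open>?p\<close> it forces the specialized matrix to be invertible.\<close>
  let ?D = "var (X 0) * var (Y (Suc n)) - var (Y 0) * var (X (Suc n)) :: 'k mpoly"
  let ?p = "?D * (a * generic_act n b - generic_act n a * b)"
  let ?V = "{X 0, Y 0, X (Suc n), Y (Suc n)}"
  have "?p \<noteq> 0"
    using neq det_poly_nonzero[of 0 "Suc n"] by simp
  then obtain c :: "pvar \<Rightarrow> 'k"
    where c: "poly_subst const (\<lambda>u. if u \<in> ?V then const (c u) else var u) ?p \<noteq> 0"
    using nonzero_specialization[OF inf, of ?V ?p] by auto
  let ?s = "\<lambda>u. if u \<in> ?V then const (c u) else var u"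
  define G :: "'k ^ 2 ^ 2"
    where "G = vector [vector [c (X 0), c (Y 0)], vector [c (X (Suc n)), c (Y (Suc n))]]"
  have fixed: "poly_subst const ?s p = p" if "p \<in> poly_ring n" for p
  proof -
    have "poly_subst const ?s p = poly_subst const var p"
      using that unfolding poly_ring_eq_polys_in by (rule poly_subst_cong) (auto simp: pvars_def)
    then show ?thesis
      by (simp add: poly_subst_var)
  qed
  have act: "poly_subst const ?s (generic_act n p) = gl2_act_poly G p" if "p \<in> poly_ring n" for p
    unfolding const_hom.subst_comp gl2_act_poly_def using that unfolding poly_ring_eq_polys_in
    by (rule poly_subst_cong)
      (auto simp: pvars_def G_def const_hom.subst_add const_hom.subst_mult const_hom.subst_var vector_2)
  have "poly_subst const ?s ?D = const (det G)"
    by (simp add: const_hom.subst_diff const_hom.subst_mult const_hom.subst_var det_2 G_def vector_2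
        const_mult const_diff)
  then have nz: "det G \<noteq> 0" "a * gl2_act_poly G b - gl2_act_poly G a * b \<noteq> 0"
    using c unfolding const_hom.subst_mult const_hom.subst_diff[of _ "a * _"] act[OF ab(1)] act[OF ab(2)]
      fixed[OF ab(1)] fixed[OF ab(2)]
    by (auto simp: const_0)
  then have G: "invertible G"
    by (simp add: invertible_det_nz)
  then have "gl2_act G q = q"
    using q(1) by (simp add: gl2_invariants_def)
  then have "Fract (gl2_act_poly G a) (gl2_act_poly G b) = Fract a b"
    unfolding q(2) gl2_act_Fract[OF G ab(3)] .
  then show False
    using nz(2) ab(3) G by (simp add: eq_fract gl2_act_poly_eq_0_iff)
qed

lemma rat_subst_var: "rat_subst (\<lambda>v. rat_of_poly (var v)) p = rat_of_poly p"
  using rat_hom.map_poly_subst[of const var p] by (simp add: rat_subst_def poly_subst_var)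

text \<open>
  If a matrix with entries \<open>m\<close> moves the point \<open>t\<close> to the generic point, then \<open>t\<close> is as good
  as the generic point: the denominator \<open>b\<close> divides its image under the generic matrix, so that
  a zero of \<open>b\<close> at \<open>t\<close> would make \<open>b\<close> vanish at the generic point.
\<close>

lemma invariant_eval:
  fixes q :: "'k::field ratfun" and t :: "pvar \<Rightarrow> 'k ratfun"
  assumes inf: "infinite (UNIV :: 'k set)" and q: "q \<in> gl2_invariants n" "lowest_terms n q a b"
    and X: "\<And>i. i \<in> {1..n} \<Longrightarrow> m11 * t (X i) + m12 * t (Y i) = rat_of_poly (var (X i))"
    and Y: "\<And>i. i \<in> {1..n} \<Longrightarrow> m21 * t (X i) + m22 * t (Y i) = rat_of_poly (var (Y i))"
  shows "rat_subst t b \<noteq> 0 \<and> q = rat_subst t a / rat_subst t b"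
proof -
  have ab: "a \<in> poly_ring n" "b \<in> poly_ring n" "b \<noteq> 0" "q = Fract a b"
    and coprime: "\<And>c. c dvd a \<Longrightarrow> c dvd b \<Longrightarrow> c dvd 1"
    using q(2) unfolding lowest_terms_def by blast+
  have eq: "a * generic_act n b = generic_act n a * b"
    using generic_invariance[OF inf q(1) ab(4,1,2,3)] .
  then have "b dvd a * generic_act n b"
    by simp
  then obtain k where k: "generic_act n b = b * k"
    using coprime_dvd_mult[OF ab(3) coprime] by blast
  \<comment> \<open>The four fresh variables receive the entries of the matrix, all others the
    coordinates of \<open>t\<close>. On \<open>poly_ring n\<close> this is evaluation at
    \<open>t\<close>; after the generic action it gives the generic point.\<close>
  define s where "s = t(X 0 := m11, Y 0 := m12, X (Suc n) := m21, Y (Suc n) := m22)"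
  have base: "rat_subst s p = rat_subst t p" if "p \<in> poly_ring n" for p
    unfolding rat_subst_def using that unfolding poly_ring_eq_polys_in
    by (rule poly_subst_cong) (auto simp: pvars_def s_def)
  have moved: "rat_subst s (generic_act n p) = rat_of_poly p" if "p \<in> poly_ring n" for p
  proof -
    have "rat_subst s (generic_act n p) = rat_subst (\<lambda>v. rat_subst s (generic_images n v)) p"
      by (simp add: rat_subst_def rconst_hom.subst_comp)
    also have "\<dots> = rat_subst (\<lambda>v. rat_of_poly (var v)) p"
      unfolding rat_subst_def using that unfolding poly_ring_eq_polys_in
      by (rule poly_subst_cong)
        (auto simp: pvars_def s_def rconst_hom.subst_add rconst_hom.subst_mult rconst_hom.subst_var X Y)
    finally show ?thesis
      by (simp add: rat_subst_var)
  qed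
  have mult: "rat_subst s (p * p') = rat_subst s p * rat_subst s p'" for p p'
    by (simp add: rat_subst_def rconst_hom.subst_mult)
  have "rat_of_poly b = rat_subst t b * rat_subst s k"
    using moved[OF ab(2)] by (simp add: k mult base ab)
  moreover have b0: "rat_of_poly b \<noteq> 0"
    using ab(3) by (simp add: rat_of_poly_eq_0_iff)
  ultimately have nz: "rat_subst t b \<noteq> 0"
    by auto
  have "rat_subst t a * rat_of_poly b = rat_of_poly a * rat_subst t b"
    using arg_cong[OF eq, of "rat_subst s"] by (simp add: mult moved base ab)
  then show ?thesis
    using nz b0 ab(3) by (simp add: ab(4) Fract_eq_divide frac_eq_eq)
qed

section \<open>The generated field\<close>

lemma is_subfield_adjoin: "is_subfield (adjoin S)"
  unfolding adjoin_def by (rule hull_in) (auto simp: is_subfield_def)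

lemma const_in_adjoin: "rat_of_poly (const c) \<in> adjoin S"
  and generator_in_adjoin: "x \<in> S \<Longrightarrow> x \<in> adjoin S"
  unfolding adjoin_def by (simp_all add: hull_inc)

lemma is_subfield_divide: "is_subfield F \<Longrightarrow> x \<in> F \<Longrightarrow> y \<in> F \<Longrightarrow> x / y \<in> F"
  by (simp add: is_subfield_def divide_inverse)

lemma rat_subst_in_adjoin:
  assumes "p \<in> poly_ring n" "\<And>v. v \<in> pvars n \<Longrightarrow> t v \<in> adjoin S"
  shows "rat_subst t p \<in> adjoin S"
  unfolding rat_subst_def
  using assms(1) unfolding poly_ring_eq_polys_in
  by (rule poly_subst_closed)
    (use assms(2) const_in_adjoin is_subfield_adjoin[of S] in \<open>auto simp: is_subfield_def\<close>)

lemma is_subfield_rat_field: "is_subfield (rat_field n)"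
  unfolding is_subfield_def
proof (intro conjI ballI)
  show "0 \<in> rat_field n" "1 \<in> rat_field n"
    unfolding rat_field_def poly_ring_eq_polys_in Zero_fract_def One_fract_def
    using polys_in_0 polys_in_1 by fastforce+
next
  fix x y :: "'a ratfun"
  assume "x \<in> rat_field n" "y \<in> rat_field n"
  then obtain a b c d where "x = Fract a b" "y = Fract c d" "b \<noteq> 0" "d \<noteq> 0"
    "a \<in> poly_ring n" "b \<in> poly_ring n" "c \<in> poly_ring n" "d \<in> poly_ring n"
    by (auto simp: rat_field_def)
  moreover from this have "x + y = Fract (a * d + c * b) (b * d)" "x * y = Fract (a * c) (b * d)"
    by simp_all
  ultimately show "x + y \<in> rat_field n" "x * y \<in> rat_field n"
    unfolding rat_field_def poly_ring_eq_polys_in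
    by (auto intro!: exI polys_in_add polys_in_mult)
next
  fix x :: "'a ratfun"
  assume "x \<in> rat_field n"
  then obtain a b where x: "x = Fract a b" "b \<noteq> 0" "a \<in> poly_ring n" "b \<in> poly_ring n"
    by (auto simp: rat_field_def)
  then have "- x = Fract (- a) b"
    by simp
  then show "- x \<in> rat_field n"
    using x polys_in_uminus unfolding rat_field_def poly_ring_eq_polys_in by blast
  show "inverse x \<in> rat_field n"
  \<comment> \<open>Since \<open>inverse 0 = 0\<close>, swapping numerator and denominator is right
    only for nonzero \<open>a\<close>.\<close>
  proof (cases "a = 0")
    case True
    then have "inverse x = Fract 0 1"
      using x by (simp add: Zero_fract_def[symmetric] fract_collapse)
    then show ?thesis
      using polys_in_0 polys_in_1 one_neq_zero unfolding rat_field_def poly_ring_eq_polys_in by blast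
  next
    case False
    then show ?thesis
      using x unfolding rat_field_def by auto
  qed
qed

section \<open>Invertible matrices act by field homomorphisms\<close>

context
  fixes G :: "'k::field ^ 2 ^ 2"
  assumes G: "invertible G"
begin

lemma gl2_act_rat_of_poly: "gl2_act G (rat_of_poly p) = rat_of_poly (gl2_act_poly G p)"
  using gl2_act_Fract[OF G, of 1 p]
  by (simp add: rat_of_poly_def gl2_act_poly_def const_hom.subst_1)

lemma gl2_act_add: "gl2_act G (x + y) = gl2_act G x + gl2_act G y"
  and gl2_act_mult: "gl2_act G (x * y) = gl2_act G x * gl2_act G y"
proof -
  obtain a b c d where xy: "x = Fract a b" "y = Fract c d" "b \<noteq> 0" "d \<noteq> 0"
    by (metis Fract_cases)
  show "gl2_act G (x + y) = gl2_act G x + gl2_act G y"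
    "gl2_act G (x * y) = gl2_act G x * gl2_act G y"
    using xy by (simp_all add: gl2_act_Fract[OF G] gl2_act_poly_eq_0_iff[OF G],
      simp_all add: gl2_act_poly_def const_hom.subst_add const_hom.subst_mult)
qed

lemma gl2_act_const: "gl2_act G (rat_of_poly (const c)) = rat_of_poly (const c)"
  by (simp add: gl2_act_rat_of_poly) (simp add: gl2_act_poly_def const_hom.subst_const)

lemma gl2_act_0: "gl2_act G 0 = 0" and gl2_act_1: "gl2_act G 1 = 1"
  using gl2_act_const[of 0] gl2_act_const[of 1]
  by (simp_all add: const_0 const_1 rat_hom.map_zero rat_hom.map_one)

lemma gl2_act_uminus: "gl2_act G (- x) = - gl2_act G x"
  using gl2_act_add[of x "- x"] by (simp add: gl2_act_0 eq_neg_iff_add_eq_0 add.commute)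

lemma gl2_act_inverse: "gl2_act G (inverse x) = inverse (gl2_act G x)"
proof (cases "x = 0")
  case False
  then have "gl2_act G x * gl2_act G (inverse x) = 1"
    by (simp flip: gl2_act_mult add: gl2_act_1)
  then show ?thesis
    by (rule inverse_unique[symmetric])
qed (simp add: gl2_act_0)

text \<open>\<open>fij i j\<close> is the determinant of the matrix with columns
  \<open>(x\<^sub>i, y\<^sub>i)\<close> and \<open>(x\<^sub>j, y\<^sub>j)\<close>, and the action
  multiplies that matrix by \<open>G\<close> from the left.\<close>

lemma gl2_act_fij: "gl2_act G (fij i j) = rat_of_poly (const (det G)) * fij i j"
proof -
  have "gl2_act_poly G (var (X i) * var (Y j) - var (Y i) * var (X j))
      = const (det G) * (var (X i) * var (Y j) - var (Y i) * var (X j))"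
    by (simp add: gl2_act_poly_def const_hom.subst_diff const_hom.subst_mult const_hom.subst_var
        det_2 const_diff const_mult algebra_simps)
  then show ?thesis
    by (simp add: fij_def gl2_act_rat_of_poly rat_hom.map_mult)
qed

text \<open>The factors \<open>det G\<close> cancel. For \<open>k = l\<close> both sides are 0, as
  division by 0 gives 0.\<close>

lemma gl2_act_fij_quotient: "gl2_act G (fij i j / fij k l) = fij i j / fij k l"
proof -
  have "rat_of_poly (const (det G)) \<noteq> 0"
    using G by (simp add: invertible_det_nz rat_of_poly_eq_0_iff const_eq_0_iff)
  then show ?thesis
    by (simp add: divide_inverse gl2_act_mult gl2_act_inverse gl2_act_fij)
qed

end

lemma is_subfield_gl2_invariants: "is_subfield (gl2_invariants n)"
  using is_subfield_rat_field[of n]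
  unfolding is_subfield_def gl2_invariants_def
  by (auto simp: gl2_act_0 gl2_act_1 gl2_act_add gl2_act_mult gl2_act_uminus gl2_act_inverse)

lemma rat_of_poly_in_rat_field: "p \<in> poly_ring n \<Longrightarrow> rat_of_poly p \<in> rat_field n"
  unfolding rat_field_def rat_of_poly_def poly_ring_eq_polys_in using polys_in_1 one_neq_zero by blast

lemma fij_in_rat_field:
  assumes "i \<in> {1..n}" "j \<in> {1..n}"
  shows "fij i j \<in> rat_field n"
  unfolding fij_def
  by (rule rat_of_poly_in_rat_field, unfold poly_ring_eq_polys_in)
    (use assms in \<open>auto simp: pvars_def intro!: polys_in_diff polys_in_mult polys_in_var\<close>)

text \<open>
  Since \<open>x\<^sub>i = x\<^sub>2 (f\<^sub>1\<^sub>i / f\<^sub>1\<^sub>2) - x\<^sub>1 (f\<^sub>2\<^sub>i / f\<^sub>1\<^sub>2)\<close> and likewise for \<open>y\<^sub>i\<close>, the matrix with rows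
  \<open>(x\<^sub>2, - x\<^sub>1)\<close> and \<open>(y\<^sub>2, - y\<^sub>1)\<close> moves the point \<open>f_images\<close> to the generic point.
\<close>

lemma invariant_eval_f_images:
  fixes q :: "'k::field ratfun"
  assumes "infinite (UNIV :: 'k set)" "q \<in> gl2_invariants n" "lowest_terms n q a b"
  shows "rat_subst f_images b \<noteq> 0 \<and> q = rat_subst f_images a / rat_subst f_images b"
proof (rule invariant_eval[OF assms])
  fix i :: nat
  have diff: "rat_of_poly (p - p') = rat_of_poly p - rat_of_poly p'" for p p' :: "'k mpoly"
    by (metis add_diff_cancel diff_add_cancel rat_hom.map_add)
  have "fij 1 2 \<noteq> (0 :: 'k ratfun)"
    unfolding fij_def rat_of_poly_eq_0_iff by (rule det_poly_nonzero) simp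
  then show "rat_of_poly (var (X 2)) * f_images (X i) + (- rat_of_poly (var (X 1))) * f_images (Y i)
      = rat_of_poly (var (X i) :: 'k mpoly)"
    "rat_of_poly (var (Y 2)) * f_images (X i) + (- rat_of_poly (var (Y 1))) * f_images (Y i)
      = rat_of_poly (var (Y i) :: 'k mpoly)"
    by (simp_all add: divide_simps) (simp_all add: fij_def diff rat_hom.map_mult algebra_simps)
qed

text \<open>Evaluating \<open>q\<close> at the point \<open>(1, 0)\<close> involves only constants,
  which lie in \<open>adjoin S\<close> for any \<open>S\<close>, in particular for the empty set of
  generators that \<open>n = 1\<close> leaves.\<close>

lemma invariant_one_in_adjoin:
  fixes q :: "'k::field ratfun"
  assumes "infinite (UNIV :: 'k set)" "q \<in> gl2_invariants 1" "lowest_terms 1 q a b"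
  shows "q \<in> adjoin S"
proof -
  define t :: "pvar \<Rightarrow> 'k ratfun" where "t v = (case v of X i \<Rightarrow> 1 | Y i \<Rightarrow> 0)" for v
  have "q = rat_subst t a / rat_subst t b"
    \<comment> \<open>The matrix with rows \<open>(x\<^sub>1, 0)\<close> and
      \<open>(y\<^sub>1, 0)\<close> moves \<open>(1, 0)\<close> to
      \<open>(x\<^sub>1, y\<^sub>1)\<close>; it is singular, which \<open>invariant_eval\<close>
      permits.\<close>
    using invariant_eval[OF assms, of "rat_of_poly (var (X 1))" t 0 "rat_of_poly (var (Y 1))" 0]
    by (simp add: t_def)
  moreover have "t v \<in> adjoin S" for v
    using is_subfield_adjoin[of S] by (auto simp: t_def is_subfield_def split: pvar.split)
  ultimately show ?thesis
    using assms(3) rat_subst_in_adjoin is_subfield_divide[OF is_subfield_adjoin]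
    unfolding lowest_terms_def by metis
qed

lemma f_images_in_adjoin:
  assumes "n \<ge> 2" "v \<in> pvars n"
  shows "f_images v \<in> adjoin {fij i j / fij k l | i j k l.
    i \<in> {1..n} \<and> j \<in> {1..n} \<and> k \<in> {1..n} \<and> l \<in> {1..n} \<and> k \<noteq> l}"
proof (rule generator_in_adjoin)
  obtain i where i: "i \<in> {1..n}" "v = X i \<or> v = Y i"
    using assms(2) by (auto simp: pvars_def)
  have "1 \<in> {1..n}" "2 \<in> {1..n}" "1 \<noteq> (2 :: nat)"
    using assms(1) by auto
  moreover have "f_images v = fij 1 i / fij 1 2 \<or> f_images v = fij 2 i / fij 1 2"
    using i(2) f_images.simps by metis
  ultimately show "f_images v \<in> {fij i j / fij k l | i j k l.
      i \<in> {1..n} \<and> j \<in> {1..n} \<and> k \<in> {1..n} \<and> l \<in> {1..n} \<and> k \<noteq> l}"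
    using i(1) by blast
qed

theorem mainTheorem1:
  fixes n :: nat
  assumes "infinite (UNIV :: 'k::field set)"
    and "n \<ge> 1"
  shows "(gl2_invariants n :: 'k ratfun set) =
           adjoin {fij i j / fij k l | i j k l.
             i \<in> {1..n} \<and> j \<in> {1..n} \<and> k \<in> {1..n} \<and> l \<in> {1..n} \<and> k \<noteq> l} \<and>
         (n \<ge> 2 \<longrightarrow>
           (\<forall>q \<in> (gl2_invariants n :: 'k ratfun set). \<forall>a b. lowest_terms n q a b \<longrightarrow>
             rat_subst f_images b \<noteq> 0 \<and>
             q = rat_subst f_images a / rat_subst f_images b))"
proof (intro conjI impI ballI allI)
  let ?S = "{fij i j / fij k l | i j k l.
    i \<in> {1..n} \<and> j \<in> {1..n} \<and> k \<in> {1..n} \<and> l \<in> {1..n} \<and> k \<noteq> l} :: 'k ratfun set"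
  show "gl2_invariants n = adjoin ?S"
  proof
    show "gl2_invariants n \<subseteq> adjoin ?S"
    proof
      fix q :: "'k ratfun"
      assume q: "q \<in> gl2_invariants n"
      then obtain a b where ab: "lowest_terms n q a b"
        using lowest_terms_exists unfolding gl2_invariants_def by blast
      show "q \<in> adjoin ?S"
      \<comment> \<open>For \<open>n = 1\<close> the field has no \<open>f\<^sub>1\<^sub>2\<close>
        to divide by, so this case rests on the point \<open>(1, 0)\<close> instead of
        \<open>f_images\<close>.\<close>
      proof (cases "n = 1")
        case True
        then show ?thesis
          using invariant_one_in_adjoin assms(1) q ab by blast
      next
        case False
        then have "n \<ge> 2"
          using assms(2) by simp
        then have "rat_subst f_images p \<in> adjoin ?S" if "p \<in> poly_ring n" for p
          using that by (intro rat_subst_in_adjoin f_images_in_adjoin)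
        then have "rat_subst f_images a / rat_subst f_images b \<in> adjoin ?S"
          using ab by (intro is_subfield_divide[OF is_subfield_adjoin]) (simp_all add: lowest_terms_def)
        then show ?thesis
          using invariant_eval_f_images[OF assms(1) q ab] by simp
      qed
    qed
    show "adjoin ?S \<subseteq> gl2_invariants n"
      unfolding adjoin_def
    \<comment> \<open>The generated field is the least subfield over its generators, so it is enough
      that the invariants form a subfield containing them.\<close>
    proof (rule hull_minimal)
      have "rat_of_poly (const c) \<in> gl2_invariants n" for c :: 'k
        by (simp add: gl2_invariants_def gl2_act_const rat_of_poly_in_rat_field
            poly_ring_eq_polys_in polys_in_const)
      moreover have "fij i j / fij k l \<in> gl2_invariants n"
        if "i \<in> {1..n}" "j \<in> {1..n}" "k \<in> {1..n}" "l \<in> {1..n}" for i j k l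
        using that is_subfield_divide[OF is_subfield_rat_field fij_in_rat_field fij_in_rat_field]
        by (simp add: gl2_invariants_def gl2_act_fij_quotient)
      ultimately show "range (\<lambda>c. rat_of_poly (const c)) \<union> ?S \<subseteq> gl2_invariants n"
        by blast
    qed (rule is_subfield_gl2_invariants)
  qed
next
  fix q :: "'k ratfun" and a b
  assume "q \<in> gl2_invariants n" "lowest_terms n q a b"
  from invariant_eval_f_images[OF assms(1) this]
  show "rat_subst f_images b \<noteq> 0" "q = rat_subst f_images a / rat_subst f_images b"
    by blast+
qed

end
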